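(* Let $M^2: z=z(u,v)$ be a surface in $\mathbb R^4$ without flat points and let $p\in M^2$. If $k>0$ at $p$, then there are no asymptotic tangents at $p$; if $k<0$ at $p$, then there are exactly two asymptotic tangents at $p$; if $k=0$ at $p$, then there is exactly one asymptotic tangent at $p$.
   Context: $M^2: z=z(u,v)$, $(u,v)\in\mathcal D\subset\mathbb R^2$, is a smooth regular 2-dimensional surface in Euclidean $\mathbb R^4$, with tangent space $T_pM^2=\mathrm{span}\{z_u,z_v\}$. $E,F,G$ are the coefficients of the first fundamental form $I(\lambda,\mu)=E\lambda^2+2F\lambda\mu+G\mu^2$, and $W=\sqrt{EG-F^2}$. $\{e_1,e_2\}$ is an orthonormal normal frame field chosen so that $\{z_u,z_v,e_1,e_2\}$ is positively oriented in $\mathbb R^4$. $\sigma$ is the vector-valued second fundamental tensor (normal part of the second derivative). The oriented area of the parallelogram of an ordered pair of normal vectors is $S(a^1e_1+a^2e_2,\;b^1e_1+b^2e_2)=a^1b^2-a^2b^1$. Put $L=\frac{2}{W}S(\sigma(z_u,z_u),\sigma(z_u,z_v))$, $M=\frac{1}{W}S(\sigma(z_u,z_u),\sigma(z_v,z_v))$, $N=\frac{2}{W}S(\sigma(z_u,z_v),\sigma(z_v,z_v))$. A point is flat if $L=M=N=0$ there. The invariant $k$ is $k=\frac{LN-M^2}{EG-F^2}$. A tangent $g$ at $p$ is a line through the origin of $T_pM^2$, determined by a nonzero vector $X=\lambda z_u+\mu z_v$. For such $g$ define the linear map $\sigma_g:T_pM^2\to(T_pM^2)^\perp$, $\sigma_g(Y)=\sigma\left(\frac{\lambda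 z_u+\mu z_v}{\sqrt{I(\lambda,\mu)}},Y\right)$. For two tangents $g_1,g_2$ at $p$ define $$\zeta_{g_1,g_2}=\frac{S(\sigma_{g_1}(z_u),\sigma_{g_2}(z_v))}{W}+\frac{S(\sigma_{g_2}(z_u),\sigma_{g_1}(z_v))}{W}.$$ Two tangents are conjugate if $\zeta_{g_1,g_2}=0$. A tangent $g$ is asymptotic if it is self-conjugate, i.e. $\zeta_{g,g}=0$. *)

theory Defs
  imports "HOL-Analysis.Analysis"
begin

definition pd_u :: "(real \<times> real \<Rightarrow> real ^ 4) \<Rightarrow> real \<times> real \<Rightarrow> real ^ 4" where
  "pd_u f p = vector_derivative (\<lambda>t. f (t, snd p)) (at (fst p))"

definition pd_v :: "(real \<times> real \<Rightarrow> real ^ 4) \<Rightarrow> real \<times> real \<Rightarrow> real ^ 4" where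
  "pd_v f p = vector_derivative (\<lambda>t. f (fst p, t)) (at (snd p))"

fun Ck_on :: "nat \<Rightarrow> (real \<times> real) set \<Rightarrow> (real \<times> real \<Rightarrow> real ^ 4) \<Rightarrow> bool" where
  "Ck_on 0 D f \<longleftrightarrow> continuous_on D f"
| "Ck_on (Suc n) D f \<longleftrightarrow>
     (\<forall>p\<in>D. f differentiable (at p)) \<and> Ck_on n D (pd_u f) \<and> Ck_on n D (pd_v f)"

text \<open>The parametrization is an immersion and need not be injective; a point of the surface is
  identified with its parameter value in \<open>D\<close>.\<close>

definition regular_surface :: "(real \<times> real) set \<Rightarrow> (real \<times> real \<Rightarrow> real ^ 4) \<Rightarrow> bool" where
  "regular_surface D z \<longleftrightarrow>
     open D \<and> (\<forall>n. Ck_on n D z) \<and>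
     (\<forall>p\<in>D. pd_u z p \<noteq> pd_v z p \<and> independent {pd_u z p, pd_v z p})"

definition tangent_space :: "(real \<times> real \<Rightarrow> real ^ 4) \<Rightarrow> real \<times> real \<Rightarrow> (real ^ 4) set" where
  "tangent_space z p = span {pd_u z p, pd_v z p}"

definition tangent_vector ::
  "(real \<times> real \<Rightarrow> real ^ 4) \<Rightarrow> real \<times> real \<Rightarrow> real \<times> real \<Rightarrow> real ^ 4" where
  "tangent_vector z p c = fst c *\<^sub>R pd_u z p + snd c *\<^sub>R pd_v z p"

definition ffE :: "(real \<times> real \<Rightarrow> real ^ 4) \<Rightarrow> real \<times> real \<Rightarrow> real" where
  "ffE z p = pd_u z p \<bullet> pd_u z p"

definition ffF :: "(real \<times> real \<Rightarrow> real ^ 4) \<Rightarrow> real \<times> real \<Rightarrow> real" where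
  "ffF z p = pd_u z p \<bullet> pd_v z p"

definition ffG :: "(real \<times> real \<Rightarrow> real ^ 4) \<Rightarrow> real \<times> real \<Rightarrow> real" where
  "ffG z p = pd_v z p \<bullet> pd_v z p"

definition ffW :: "(real \<times> real \<Rightarrow> real ^ 4) \<Rightarrow> real \<times> real \<Rightarrow> real" where
  "ffW z p = sqrt (ffE z p * ffG z p - (ffF z p)\<^sup>2)"

definition first_form :: "(real \<times> real \<Rightarrow> real ^ 4) \<Rightarrow> real \<times> real \<Rightarrow> real \<times> real \<Rightarrow> real" where
  "first_form z p c =
     ffE z p * (fst c)\<^sup>2 + 2 * ffF z p * fst c * snd c + ffG z p * (snd c)\<^sup>2"

text \<open>No regularity of \<open>e1\<close> and \<open>e2\<close> is required: they enter only pointwise, through the oriented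
  area of normal vectors.\<close>

definition positive_normal_frame ::
  "(real \<times> real) set \<Rightarrow> (real \<times> real \<Rightarrow> real ^ 4) \<Rightarrow>
   (real \<times> real \<Rightarrow> real ^ 4) \<Rightarrow> (real \<times> real \<Rightarrow> real ^ 4) \<Rightarrow> bool" where
  "positive_normal_frame D z e1 e2 \<longleftrightarrow>
     (\<forall>p\<in>D. e1 p \<in> (tangent_space z p)\<^sup>\<bottom> \<and> e2 p \<in> (tangent_space z p)\<^sup>\<bottom> \<and>
        norm (e1 p) = 1 \<and> norm (e2 p) = 1 \<and> orthogonal (e1 p) (e2 p) \<and>
        det (vector [pd_u z p, pd_v z p, e1 p, e2 p] :: real ^ 4 ^ 4) > 0)"

definition normal_part :: "(real \<times> real \<Rightarrow> real ^ 4) \<Rightarrow> real \<times> real \<Rightarrow> real ^ 4 \<Rightarrow> real ^ 4" where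
  "normal_part z p w = (THE n. n \<in> (tangent_space z p)\<^sup>\<bottom> \<and> w - n \<in> tangent_space z p)"

definition tangent_coords ::
  "(real \<times> real \<Rightarrow> real ^ 4) \<Rightarrow> real \<times> real \<Rightarrow> real ^ 4 \<Rightarrow> real \<times> real" where
  "tangent_coords z p X = (THE c. X = tangent_vector z p c)"

text \<open>The second fundamental tensor; meaningful for \<open>X\<close> and \<open>Y\<close> in the tangent space. Since \<open>z\<close> is
  smooth, the mixed second derivatives agree and one of them represents both.\<close>

definition sigma ::
  "(real \<times> real \<Rightarrow> real ^ 4) \<Rightarrow> real \<times> real \<Rightarrow> real ^ 4 \<Rightarrow> real ^ 4 \<Rightarrow> real ^ 4" where
  "sigma z p X Y =
     (let a = tangent_coords z p X; b = tangent_coords z p Y in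
      normal_part z p
        ((fst a * fst b) *\<^sub>R pd_u (pd_u z) p
         + (fst a * snd b + snd a * fst b) *\<^sub>R pd_v (pd_u z) p
         + (snd a * snd b) *\<^sub>R pd_v (pd_v z) p))"

text \<open>For an orthonormal frame the components of a normal vector \<open>a\<close> are the inner products
  \<open>a \<bullet> e1\<close> and \<open>a \<bullet> e2\<close>. Here \<open>n1\<close> and \<open>n2\<close> are the frame vectors at a single point.\<close>

definition oriented_area :: "real ^ 4 \<Rightarrow> real ^ 4 \<Rightarrow> real ^ 4 \<Rightarrow> real ^ 4 \<Rightarrow> real" where
  "oriented_area n1 n2 a b = (a \<bullet> n1) * (b \<bullet> n2) - (a \<bullet> n2) * (b \<bullet> n1)"

definition coef_L ::
  "(real \<times> real \<Rightarrow> real ^ 4) \<Rightarrow> (real \<times> real \<Rightarrow> real ^ 4) \<Rightarrow> (real \<times> real \<Rightarrow> real ^ 4) \<Rightarrow>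
   real \<times> real \<Rightarrow> real" where
  "coef_L z e1 e2 p = 2 / ffW z p *
     oriented_area (e1 p) (e2 p)
       (sigma z p (pd_u z p) (pd_u z p)) (sigma z p (pd_u z p) (pd_v z p))"

definition coef_M ::
  "(real \<times> real \<Rightarrow> real ^ 4) \<Rightarrow> (real \<times> real \<Rightarrow> real ^ 4) \<Rightarrow> (real \<times> real \<Rightarrow> real ^ 4) \<Rightarrow>
   real \<times> real \<Rightarrow> real" where
  "coef_M z e1 e2 p = 1 / ffW z p *
     oriented_area (e1 p) (e2 p)
       (sigma z p (pd_u z p) (pd_u z p)) (sigma z p (pd_v z p) (pd_v z p))"

definition coef_N ::
  "(real \<times> real \<Rightarrow> real ^ 4) \<Rightarrow> (real \<times> real \<Rightarrow> real ^ 4) \<Rightarrow> (real \<times> real \<Rightarrow> real ^ 4) \<Rightarrow>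
   real \<times> real \<Rightarrow> real" where
  "coef_N z e1 e2 p = 2 / ffW z p *
     oriented_area (e1 p) (e2 p)
       (sigma z p (pd_u z p) (pd_v z p)) (sigma z p (pd_v z p) (pd_v z p))"

definition flat_point ::
  "(real \<times> real \<Rightarrow> real ^ 4) \<Rightarrow> (real \<times> real \<Rightarrow> real ^ 4) \<Rightarrow> (real \<times> real \<Rightarrow> real ^ 4) \<Rightarrow>
   real \<times> real \<Rightarrow> bool" where
  "flat_point z e1 e2 p \<longleftrightarrow>
     coef_L z e1 e2 p = 0 \<and> coef_M z e1 e2 p = 0 \<and> coef_N z e1 e2 p = 0"

definition invariant_k ::
  "(real \<times> real \<Rightarrow> real ^ 4) \<Rightarrow> (real \<times> real \<Rightarrow> real ^ 4) \<Rightarrow> (real \<times> real \<Rightarrow> real ^ 4) \<Rightarrow>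
   real \<times> real \<Rightarrow> real" where
  "invariant_k z e1 e2 p =
     (coef_L z e1 e2 p * coef_N z e1 e2 p - (coef_M z e1 e2 p)\<^sup>2) /
     (ffE z p * ffG z p - (ffF z p)\<^sup>2)"

text \<open>A nonzero coordinate pair \<open>c\<close> determines a tangent, i.e. a line in the tangent space.\<close>

definition tangent_line ::
  "(real \<times> real \<Rightarrow> real ^ 4) \<Rightarrow> real \<times> real \<Rightarrow> real \<times> real \<Rightarrow> (real ^ 4) set" where
  "tangent_line z p c = span {tangent_vector z p c}"

definition tangents :: "(real \<times> real \<Rightarrow> real ^ 4) \<Rightarrow> real \<times> real \<Rightarrow> (real ^ 4) set set" where
  "tangents z p = {tangent_line z p c | c. c \<noteq> 0}"

definition sigma_dir ::
  "(real \<times> real \<Rightarrow> real ^ 4) \<Rightarrow> real \<times> real \<Rightarrow> real \<times> real \<Rightarrow> real ^ 4 \<Rightarrow> real ^ 4" where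
  "sigma_dir z p c Y = sigma z p (tangent_vector z p c /\<^sub>R sqrt (first_form z p c)) Y"

definition zeta ::
  "(real \<times> real \<Rightarrow> real ^ 4) \<Rightarrow> (real \<times> real \<Rightarrow> real ^ 4) \<Rightarrow> (real \<times> real \<Rightarrow> real ^ 4) \<Rightarrow>
   real \<times> real \<Rightarrow> real \<times> real \<Rightarrow> real \<times> real \<Rightarrow> real" where
  "zeta z e1 e2 p c1 c2 =
     oriented_area (e1 p) (e2 p)
       (sigma_dir z p c1 (pd_u z p)) (sigma_dir z p c2 (pd_v z p)) / ffW z p +
     oriented_area (e1 p) (e2 p)
       (sigma_dir z p c2 (pd_u z p)) (sigma_dir z p c1 (pd_v z p)) / ffW z p"

text \<open>Replacing \<open>c1\<close> or \<open>c2\<close> by a nonzero multiple changes \<open>zeta\<close> at most by its sign, so the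
  choice of vectors directing the two lines is immaterial below.\<close>

definition conjugate_tangents ::
  "(real \<times> real \<Rightarrow> real ^ 4) \<Rightarrow> (real \<times> real \<Rightarrow> real ^ 4) \<Rightarrow> (real \<times> real \<Rightarrow> real ^ 4) \<Rightarrow>
   real \<times> real \<Rightarrow> (real ^ 4) set \<Rightarrow> (real ^ 4) set \<Rightarrow> bool" where
  "conjugate_tangents z e1 e2 p g1 g2 \<longleftrightarrow>
     (\<exists>c1 c2. c1 \<noteq> 0 \<and> c2 \<noteq> 0 \<and> g1 = tangent_line z p c1 \<and> g2 = tangent_line z p c2 \<and>
        zeta z e1 e2 p c1 c2 = 0)"

definition asymptotic_tangents ::
  "(real \<times> real \<Rightarrow> real ^ 4) \<Rightarrow> (real \<times> real \<Rightarrow> real ^ 4) \<Rightarrow> (real \<times> real \<Rightarrow> real ^ 4) \<Rightarrow>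
   real \<times> real \<Rightarrow> (real ^ 4) set set" where
  "asymptotic_tangents z e1 e2 p = {g \<in> tangents z p. conjugate_tangents z e1 e2 p g g}"

end

theory Submission
  imports Defs
begin

text \<open>
  The two area terms of \<open>zeta\<close> are bilinear in the direction vectors. Expanding them by
  bilinearity and antisymmetry of the oriented area turns \<open>zeta\<close> into the polar form of
  the binary quadratic form \<open>L \<lambda>\<^sup>2 + 2 M \<lambda> \<mu> + N \<mu>\<^sup>2\<close>, divided by the lengths of the two vectors
  (\<open>zeta_eq_polar_form\<close>). The asymptotic tangents at \<open>p\<close> are therefore the projective zeros of
  this form, which is nonzero because \<open>p\<close> is not flat. Since \<open>EG - F\<^sup>2 > 0\<close>, the sign of \<open>k\<close> is that
  of the determinant \<open>LN - M\<^sup>2\<close>: if it is positive the form is definite; otherwise the form is a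
  product of two real linear factors, which are proportional exactly when the determinant
  vanishes (\<open>binary_form_factors\<close>).

  Regularity enters through the injectivity of \<open>tangent_vector z p\<close>: it gives \<open>EG - F\<^sup>2 > 0\<close> and
  identifies the lines in the tangent space with the nonzero coordinate pairs up to scaling.
\<close>

section \<open>Binary quadratic forms\<close>

definition parallel :: "real \<times> real \<Rightarrow> real \<times> real \<Rightarrow> bool" where
  "parallel c d \<longleftrightarrow> fst c * snd d = snd c * fst d"

definition polar_form :: "real \<Rightarrow> real \<Rightarrow> real \<Rightarrow> real \<times> real \<Rightarrow> real \<times> real \<Rightarrow> real" where
  "polar_form L M N c d =
     L * fst c * fst d + M * (fst c * snd d + snd c * fst d) + N * snd c * snd d"

lemma parallel_imp_multiple:
  assumes "c \<noteq> 0" "d \<noteq> 0" "parallel c d"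
  obtains t where "t \<noteq> 0" "d = t *\<^sub>R c"
proof (cases "fst c = 0")
  case True
  then have "snd c \<noteq> 0" "fst d = 0"
    using assms by (auto simp: parallel_def prod_eq_iff)
  with True assms(2) have "snd d / snd c \<noteq> 0" "d = (snd d / snd c) *\<^sub>R c"
    by (auto simp: prod_eq_iff)
  then show ?thesis by (rule that)
next
  case False
  have "fst d \<noteq> 0"
    using assms False by (auto simp: parallel_def prod_eq_iff)
  with False assms(3) have "fst d / fst c \<noteq> 0" "d = (fst d / fst c) *\<^sub>R c"
    by (auto simp: prod_eq_iff parallel_def field_simps)
  then show ?thesis by (rule that)
qed

lemma mult_polar_form_diag:
  "L * polar_form L M N c c = (L * fst c + M * snd c)\<^sup>2 + (L * N - M\<^sup>2) * (snd c)\<^sup>2"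
  by (simp add: polar_form_def power2_eq_square algebra_simps)

lemma definite_form_no_zero:
  assumes "L * N - M\<^sup>2 > 0" "c \<noteq> 0"
  shows "polar_form L M N c c \<noteq> 0"
proof
  assume zero: "polar_form L M N c c = 0"
  have "L \<noteq> 0" using assms(1) by auto
  have sum0: "(L * fst c + M * snd c)\<^sup>2 + (L * N - M\<^sup>2) * (snd c)\<^sup>2 = 0"
    using mult_polar_form_diag[of L M N c] zero by simp
  moreover have "(L * N - M\<^sup>2) * (snd c)\<^sup>2 \<ge> 0" using assms(1) by simp
  ultimately have "(L * N - M\<^sup>2) * (snd c)\<^sup>2 = 0"
    using zero_le_power2[of "L * fst c + M * snd c"] by linarith
  then have "snd c = 0" using assms(1) by simp
  with sum0 \<open>L \<noteq> 0\<close> have "fst c = 0" by simp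
  with \<open>snd c = 0\<close> assms(2) show False by (simp add: prod_eq_iff)
qed

text \<open>
  For \<open>L \<noteq> 0\<close>, completing the square leaves a difference of two squares, whose factors vanish on
  the directions \<open>(\<plusminus>r - M, L)\<close> with \<open>r\<^sup>2 = M\<^sup>2 - LN\<close>. For \<open>L = 0\<close> the form is already the product
  \<open>\<mu> (2 M \<lambda> + N \<mu>)\<close>.
\<close>

lemma binary_form_factors:
  assumes "\<not> (L = 0 \<and> M = 0 \<and> N = 0)" "L * N - M\<^sup>2 \<le> 0"
  obtains c d where "c \<noteq> 0" "d \<noteq> 0"
    "\<And>x. polar_form L M N x x = 0 \<longleftrightarrow> parallel x c \<or> parallel x d"
    "parallel c d \<longleftrightarrow> L * N - M\<^sup>2 = 0"
proof (cases "L = 0")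
  case True
  show ?thesis
  proof (rule that[of "(1, 0)" "(N, -2 * M)"])
    show "(N, -2 * M) \<noteq> 0" using assms(1) True by (auto simp: prod_eq_iff)
    fix x
    have "polar_form L M N x x = snd x * (2 * M * fst x + N * snd x)"
      using True by (simp add: polar_form_def algebra_simps)
    then show "polar_form L M N x x = 0 \<longleftrightarrow> parallel x (1, 0) \<or> parallel x (N, -2 * M)"
      by (simp add: parallel_def) (smt (verit) mult.commute mult_minus_right)
  qed (use True in \<open>auto simp: parallel_def prod_eq_iff\<close>)
next
  case False
  define r where "r = sqrt (M\<^sup>2 - L * N)"
  have r2: "r\<^sup>2 = M\<^sup>2 - L * N" using assms(2) by (simp add: r_def)
  show ?thesis
  proof (rule that[of "(r - M, L)" "(- r - M, L)"])
    fix x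
    have "L * polar_form L M N x x = (L * fst x + M * snd x)\<^sup>2 - r\<^sup>2 * (snd x)\<^sup>2"
      by (simp add: mult_polar_form_diag r2 algebra_simps)
    also have "\<dots> = (L * fst x - (r - M) * snd x) * (L * fst x - (- r - M) * snd x)"
      by (simp add: power2_eq_square algebra_simps)
    finally have "polar_form L M N x x = 0 \<longleftrightarrow>
        L * fst x = (r - M) * snd x \<or> L * fst x = (- r - M) * snd x"
      using False by (metis eq_iff_diff_eq_0 mult_eq_0_iff)
    then show "polar_form L M N x x = 0 \<longleftrightarrow> parallel x (r - M, L) \<or> parallel x (- r - M, L)"
      by (simp add: parallel_def mult.commute)
  next
    have "parallel (r - M, L) (- r - M, L) \<longleftrightarrow> r = 0"
      using False by (simp add: parallel_def mult.commute)
    also have "\<dots> \<longleftrightarrow> L * N - M\<^sup>2 = 0"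
      using r2 by (metis eq_iff_diff_eq_0 zero_eq_power2)
    finally show "parallel (r - M, L) (- r - M, L) \<longleftrightarrow> L * N - M\<^sup>2 = 0" .
  qed (use False in \<open>auto simp: prod_eq_iff\<close>)
qed

section \<open>Tangent vectors, tangent lines and the first fundamental form\<close>

lemma tangent_vector_scaleR: "tangent_vector z p (t *\<^sub>R c) = t *\<^sub>R tangent_vector z p c"
  by (simp add: tangent_vector_def scaleR_add_right)

lemma pd_u_eq_tangent_vector: "pd_u z p = tangent_vector z p (1, 0)"
  and pd_v_eq_tangent_vector: "pd_v z p = tangent_vector z p (0, 1)"
  by (simp_all add: tangent_vector_def)

lemma inj_tangent_vector:
  assumes "pd_u z p \<noteq> pd_v z p" "independent {pd_u z p, pd_v z p}"
  shows "inj (tangent_vector z p)"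
proof -
  have "linear (tangent_vector z p)"
    by (rule linearI) (simp_all add: tangent_vector_def algebra_simps)
  moreover have "c = 0" if "tangent_vector z p c = 0" for c
  proof -
    have notin: "pd_u z p \<notin> span {pd_v z p}" and "pd_v z p \<noteq> 0"
      using assms by (auto simp: independent_insert)
    have eq: "fst c *\<^sub>R pd_u z p = - (snd c *\<^sub>R pd_v z p)"
      using that by (simp add: tangent_vector_def eq_neg_iff_add_eq_0)
    have "fst c = 0"
    proof (rule ccontr)
      assume "fst c \<noteq> 0"
      have "fst c *\<^sub>R pd_u z p \<in> span {pd_v z p}"
        unfolding eq by (intro span_neg span_scale span_base) simp
      then have "(1 / fst c) *\<^sub>R (fst c *\<^sub>R pd_u z p) \<in> span {pd_v z p}"
        by (rule span_scale)
      with \<open>fst c \<noteq> 0\<close> notin show False by simp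
    qed
    with eq \<open>pd_v z p \<noteq> 0\<close> show "c = 0" by (simp add: prod_eq_iff)
  qed
  ultimately show ?thesis by (simp add: linear_injective_0)
qed

lemma tangent_coords_tangent_vector:
  assumes "inj (tangent_vector z p)"
  shows "tangent_coords z p (tangent_vector z p c) = c"
  unfolding tangent_coords_def using assms by (auto simp: inj_eq)

lemma tangent_line_eq_iff:
  assumes inj: "inj (tangent_vector z p)" and "c \<noteq> 0" "d \<noteq> 0"
  shows "tangent_line z p c = tangent_line z p d \<longleftrightarrow> parallel c d"
proof
  assume "tangent_line z p c = tangent_line z p d"
  then have "tangent_vector z p d \<in> span {tangent_vector z p c}"
    by (simp add: tangent_line_def span_base)
  then obtain t where "tangent_vector z p d = tangent_vector z p (t *\<^sub>R c)"
    by (auto simp: span_singleton tangent_vector_scaleR)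
  then have "d = t *\<^sub>R c" using inj by (simp add: inj_eq)
  then show "parallel c d" by (simp add: parallel_def)
next
  assume "parallel c d"
  then obtain t where "t \<noteq> 0" "d = t *\<^sub>R c"
    using assms parallel_imp_multiple by blast
  then show "tangent_line z p c = tangent_line z p d"
    by (simp add: tangent_line_def tangent_vector_scaleR span_image_scale[of "{_}" "\<lambda>_. t", simplified])
qed

lemma first_form_eq_norm: "first_form z p c = (norm (tangent_vector z p c))\<^sup>2"
  unfolding first_form_def ffE_def ffF_def ffG_def tangent_vector_def power2_norm_eq_inner
  by (simp add: inner_add_left inner_add_right inner_commute[of "pd_v z p" "pd_u z p"]
      power2_eq_square algebra_simps)

lemma first_form_pos:
  assumes inj: "inj (tangent_vector z p)" and "c \<noteq> 0"
  shows "first_form z p c > 0"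
proof -
  have "tangent_vector z p 0 = 0" by (simp add: tangent_vector_def)
  then have "tangent_vector z p c \<noteq> 0" using assms by (metis injD)
  then show ?thesis by (simp add: first_form_eq_norm)
qed

lemma first_form_det_pos:
  assumes inj: "inj (tangent_vector z p)"
  shows "ffE z p * ffG z p - (ffF z p)\<^sup>2 > 0"
proof -
  have E: "ffE z p > 0"
    using first_form_pos[OF inj, of "(1, 0)"] by (simp add: first_form_def prod_eq_iff)
  \<comment> \<open>The vector \<open>E z\<^sub>v - F z\<^sub>u\<close>, orthogonal to \<open>z\<^sub>u\<close>, has squared length \<open>E (EG - F\<^sup>2)\<close>.\<close>
  have "first_form z p (- ffF z p, ffE z p) > 0"
    using first_form_pos[OF inj] E by (simp add: prod_eq_iff)
  also have "first_form z p (- ffF z p, ffE z p) = ffE z p * (ffE z p * ffG z p - (ffF z p)\<^sup>2)"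
    by (simp add: first_form_def power2_eq_square algebra_simps)
  finally show ?thesis using E by (simp add: zero_less_mult_iff)
qed

section \<open>Asymptotic tangents as zeros of a quadratic form\<close>

lemma inner_normal_part:
  assumes "n \<in> (tangent_space z p)\<^sup>\<bottom>"
  shows "normal_part z p w \<bullet> n = w \<bullet> n"
proof -
  let ?T = "tangent_space z p"
  have sub: "subspace ?T" by (simp add: tangent_space_def)
  have "\<exists>!m. m \<in> ?T\<^sup>\<bottom> \<and> w - m \<in> ?T"
  proof (rule ex_ex1I)
    obtain y m where "y \<in> ?T" "\<And>x. x \<in> ?T \<Longrightarrow> orthogonal m x" "w = y + m"
      using orthogonal_subspace_decomp_exists[of "{pd_u z p, pd_v z p}" w]
      unfolding tangent_space_def by metis
    then show "\<exists>m. m \<in> ?T\<^sup>\<bottom> \<and> w - m \<in> ?T"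
      by (auto simp: orthogonal_comp_def orthogonal_commute intro!: exI[of _ m])
  next
    fix m m' assume m: "m \<in> ?T\<^sup>\<bottom> \<and> w - m \<in> ?T" and m': "m' \<in> ?T\<^sup>\<bottom> \<and> w - m' \<in> ?T"
    have "m' - m \<in> ?T"
      using subspace_diff[OF sub, of "w - m" "w - m'"] m m' by simp
    moreover have "m' - m \<in> ?T\<^sup>\<bottom>"
      using m m' subspace_orthogonal_comp subspace_diff by blast
    ultimately have "orthogonal (m' - m) (m' - m)" by (simp add: orthogonal_comp_def)
    then show "m = m'" by (simp add: orthogonal_self)
  qed
  from theI'[OF this] have "w - normal_part z p w \<in> ?T"
    unfolding normal_part_def by blast
  with assms have "(w - normal_part z p w) \<bullet> n = 0"
    by (auto simp: orthogonal_comp_def orthogonal_def)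
  then show ?thesis by (simp add: inner_diff_left)
qed

text \<open>
  Against a fixed normal vector the second fundamental tensor is a symmetric bilinear form in the
  coordinates, with the components of \<open>z\<^sub>u\<^sub>u\<close>, \<open>z\<^sub>u\<^sub>v\<close>, \<open>z\<^sub>v\<^sub>v\<close> as coefficients.
\<close>

lemma inner_sigma:
  assumes inj: "inj (tangent_vector z p)" and n: "n \<in> (tangent_space z p)\<^sup>\<bottom>"
  shows "sigma z p (tangent_vector z p a) (tangent_vector z p b) \<bullet> n =
    polar_form (pd_u (pd_u z) p \<bullet> n) (pd_v (pd_u z) p \<bullet> n) (pd_v (pd_v z) p \<bullet> n) a b"
  by (simp add: sigma_def Let_def tangent_coords_tangent_vector[OF inj] inner_normal_part[OF n]
      inner_add_left polar_form_def mult.commute mult.left_commute)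

lemma zeta_eq_polar_form:
  assumes inj: "inj (tangent_vector z p)"
    and n1: "e1 p \<in> (tangent_space z p)\<^sup>\<bottom>" and n2: "e2 p \<in> (tangent_space z p)\<^sup>\<bottom>"
  shows "zeta z e1 e2 p c d =
    polar_form (coef_L z e1 e2 p) (coef_M z e1 e2 p) (coef_N z e1 e2 p) c d /
      (sqrt (first_form z p c) * sqrt (first_form z p d))"
proof -
  have uu: "sigma z p (pd_u z p) (pd_u z p) \<bullet> n = pd_u (pd_u z) p \<bullet> n"
    and uv: "sigma z p (pd_u z p) (pd_v z p) \<bullet> n = pd_v (pd_u z) p \<bullet> n"
    and vv: "sigma z p (pd_v z p) (pd_v z p) \<bullet> n = pd_v (pd_v z) p \<bullet> n"
    if "n \<in> (tangent_space z p)\<^sup>\<bottom>" for n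
    unfolding pd_u_eq_tangent_vector[of z p] pd_v_eq_tangent_vector[of z p] inner_sigma[OF inj that]
    by (simp_all add: polar_form_def)
  have dir_u: "sigma_dir z p c (pd_u z p) \<bullet> n =
      (fst c * (pd_u (pd_u z) p \<bullet> n) + snd c * (pd_v (pd_u z) p \<bullet> n)) / sqrt (first_form z p c)"
    and dir_v: "sigma_dir z p c (pd_v z p) \<bullet> n =
      (fst c * (pd_v (pd_u z) p \<bullet> n) + snd c * (pd_v (pd_v z) p \<bullet> n)) / sqrt (first_form z p c)"
    if "n \<in> (tangent_space z p)\<^sup>\<bottom>" for n c
    unfolding sigma_dir_def tangent_vector_scaleR[symmetric]
      pd_u_eq_tangent_vector[of z p] pd_v_eq_tangent_vector[of z p] inner_sigma[OF inj that]
    by (simp_all add: polar_form_def divide_inverse algebra_simps)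
  define s t W where "s = inverse (sqrt (first_form z p c))"
    and "t = inverse (sqrt (first_form z p d))" and "W = inverse (ffW z p)"
  show ?thesis
    unfolding zeta_def oriented_area_def coef_L_def coef_M_def coef_N_def
      uu[OF n1] uu[OF n2] uv[OF n1] uv[OF n2] vv[OF n1] vv[OF n2]
      dir_u[OF n1] dir_u[OF n2] dir_v[OF n1] dir_v[OF n2] polar_form_def divide_inverse
      inverse_mult_distrib s_def[symmetric] t_def[symmetric] W_def[symmetric]
    by (simp add: algebra_simps)
qed

text \<open>
  Self-conjugacy of a line quantifies over two direction vectors of it; these are proportional, so
  the polar form at the pair is a nonzero multiple of the quadratic form at either of them.
\<close>

lemma asymptotic_tangents_eq:
  assumes inj: "inj (tangent_vector z p)"
    and n1: "e1 p \<in> (tangent_space z p)\<^sup>\<bottom>" and n2: "e2 p \<in> (tangent_space z p)\<^sup>\<bottom>"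
  defines "Q \<equiv> polar_form (coef_L z e1 e2 p) (coef_M z e1 e2 p) (coef_N z e1 e2 p)"
  shows "asymptotic_tangents z e1 e2 p = tangent_line z p ` {c. c \<noteq> 0 \<and> Q c c = 0}"
proof -
  have zeta0: "zeta z e1 e2 p c d = 0 \<longleftrightarrow> Q c d = 0" if "c \<noteq> 0" "d \<noteq> 0" for c d
    using first_form_pos[OF inj that(1)] first_form_pos[OF inj that(2)]
    unfolding zeta_eq_polar_form[of z p e1 e2, OF inj n1 n2] Q_def by simp
  have diag0: "Q c c = 0"
    if cd: "c \<noteq> 0" "d \<noteq> 0" "tangent_line z p c = tangent_line z p d" "Q c d = 0" for c d
  proof -
    have "parallel c d" using cd(3) tangent_line_eq_iff[OF inj cd(1,2)] by simp
    then obtain t where "t \<noteq> 0" "d = t *\<^sub>R c" using parallel_imp_multiple[OF cd(1,2)] by metis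
    moreover have "Q c (t *\<^sub>R c) = t * Q c c"
      by (simp add: Q_def polar_form_def algebra_simps)
    ultimately show ?thesis using cd(4) by simp
  qed
  show ?thesis
  proof (intro set_eqI iffI)
    fix g assume "g \<in> asymptotic_tangents z e1 e2 p"
    then obtain c d where cd: "c \<noteq> 0" "d \<noteq> 0" "g = tangent_line z p c" "g = tangent_line z p d"
      "zeta z e1 e2 p c d = 0"
      unfolding asymptotic_tangents_def conjugate_tangents_def by auto
    then have "Q c c = 0" using diag0[of c d] zeta0[of c d] by simp
    with cd show "g \<in> tangent_line z p ` {c. c \<noteq> 0 \<and> Q c c = 0}" by simp
  next
    fix g assume "g \<in> tangent_line z p ` {c. c \<noteq> 0 \<and> Q c c = 0}"
    then obtain c where c: "c \<noteq> 0" "Q c c = 0" "g = tangent_line z p c" by auto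
    with zeta0[of c c] have "zeta z e1 e2 p c c = 0" by simp
    with c show "g \<in> asymptotic_tangents z e1 e2 p"
      unfolding asymptotic_tangents_def conjugate_tangents_def tangents_def by blast
  qed
qed

theorem mainTheorem6:
  fixes D :: "(real \<times> real) set"
    and z e1 e2 :: "real \<times> real \<Rightarrow> real ^ 4"
    and p :: "real \<times> real"
  assumes "regular_surface D z"
    and "positive_normal_frame D z e1 e2"
    and "\<forall>q\<in>D. \<not> flat_point z e1 e2 q"
    and "p \<in> D"
  shows "(invariant_k z e1 e2 p > 0 \<longrightarrow> asymptotic_tangents z e1 e2 p = {}) \<and>
         (invariant_k z e1 e2 p < 0 \<longrightarrow> card (asymptotic_tangents z e1 e2 p) = 2) \<and>
         (invariant_k z e1 e2 p = 0 \<longrightarrow> card (asymptotic_tangents z e1 e2 p) = 1)"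
proof -
  define L M N where "L = coef_L z e1 e2 p" and "M = coef_M z e1 e2 p" and "N = coef_N z e1 e2 p"
  have inj: "inj (tangent_vector z p)"
    using assms(1,4) by (auto simp: regular_surface_def intro!: inj_tangent_vector)
  have normal: "e1 p \<in> (tangent_space z p)\<^sup>\<bottom>" "e2 p \<in> (tangent_space z p)\<^sup>\<bottom>"
    using assms(2,4) by (auto simp: positive_normal_frame_def)
  have nonzero: "\<not> (L = 0 \<and> M = 0 \<and> N = 0)"
    using assms(3,4) by (auto simp: flat_point_def L_def M_def N_def)
  have asym: "asymptotic_tangents z e1 e2 p =
      tangent_line z p ` {c. c \<noteq> 0 \<and> polar_form L M N c c = 0}"
    unfolding L_def M_def N_def by (rule asymptotic_tangents_eq[of z p e1 e2, OF inj normal])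
  have k: "invariant_k z e1 e2 p = (L * N - M\<^sup>2) / (ffE z p * ffG z p - (ffF z p)\<^sup>2)"
    by (simp add: invariant_k_def L_def M_def N_def)
  have k_sign: "invariant_k z e1 e2 p > 0 \<longleftrightarrow> L * N - M\<^sup>2 > 0"
    "invariant_k z e1 e2 p < 0 \<longleftrightarrow> L * N - M\<^sup>2 < 0"
    "invariant_k z e1 e2 p = 0 \<longleftrightarrow> L * N - M\<^sup>2 = 0"
    unfolding k using first_form_det_pos[OF inj]
    by (simp_all add: zero_less_divide_iff divide_less_0_iff)
  have two_lines: "card (asymptotic_tangents z e1 e2 p) = (if L * N - M\<^sup>2 = 0 then 1 else 2)"
    if le: "L * N - M\<^sup>2 \<le> 0"
  proof -
    obtain c d where cd: "c \<noteq> 0" "d \<noteq> 0"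
      "\<And>x. polar_form L M N x x = 0 \<longleftrightarrow> parallel x c \<or> parallel x d"
      "parallel c d \<longleftrightarrow> L * N - M\<^sup>2 = 0"
      by (rule binary_form_factors[OF nonzero le]) (rule that)
    have refl: "parallel x x" for x by (simp add: parallel_def)
    have "asymptotic_tangents z e1 e2 p = {tangent_line z p c, tangent_line z p d}"
    proof
      show "asymptotic_tangents z e1 e2 p \<subseteq> {tangent_line z p c, tangent_line z p d}"
      proof
        fix g assume "g \<in> asymptotic_tangents z e1 e2 p"
        then obtain x where x: "x \<noteq> 0" "polar_form L M N x x = 0" "g = tangent_line z p x"
          unfolding asym by blast
        then have "parallel x c \<or> parallel x d" using cd(3) by simp
        then show "g \<in> {tangent_line z p c, tangent_line z p d}"
          using x(3) tangent_line_eq_iff[OF inj x(1) cd(1)] tangent_line_eq_iff[OF inj x(1) cd(2)]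
          by simp
      qed
      show "{tangent_line z p c, tangent_line z p d} \<subseteq> asymptotic_tangents z e1 e2 p"
        unfolding asym using cd(1-3) refl by blast
    qed
    then show ?thesis
      using tangent_line_eq_iff[OF inj cd(1,2)] cd(4) by auto
  qed
  have "asymptotic_tangents z e1 e2 p = {}" if "L * N - M\<^sup>2 > 0"
    unfolding asym using definite_form_no_zero[OF that] by blast
  with two_lines show ?thesis unfolding k_sign by simp
qed

end
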